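(* Let $K=\mathbb R$ or $K=\mathbb C$, and let $E$ be any right nilpotent $n$-dimensional evolution algebra over $K$ with natural basis $e_1,\dots,e_n$. Then for any $x=\sum_i x_ie_i\in E$ the evolution algebra $E_x$ (the approximation of $E$ at $x$ with respect to this basis) is right nilpotent.
   Context: An $n$-dimensional evolution algebra is an algebra (bilinear multiplication) with a basis $e_1,\dots,e_n$ (a natural basis) such that $e_ie_j=0$ for $i\neq j$ and $e_ie_i=\sum_k a_{ik}e_k$; $(a_{ik})$ is its matrix of structural constants. For an $n$-dimensional algebra $\mathcal A$ with basis $e_1,\dots,e_n$ and structural constants $\gamma_{ij,k}$, i.e. $e_ie_j=\sum_k\gamma_{ij,k}e_k$, and for $x=\sum_i x_ie_i\in\mathcal A$, the approximation of $\mathcal A$ at $x$ is the evolution algebra $E_x$ with natural basis $\tilde e_1,\dots,\tilde e_n$ and multiplication $\tilde e_p\tilde e_q=0$ for $p\neq q$, $\tilde e_p^2=\sum_k\beta_{pk}(x)\tilde e_k$, where $\beta_{pk}(x)=\sum_{i}(\gamma_{pi,k}+\gamma_{ip,k})x_i$. In the statement this is applied with $\mathcal A=E$ and the natural basis of $E$ (so $\gamma_{ii,k}=a_{ik}$ and $\gamma_{ij,k}=0$ for $i\ne j$). For an evolution algebra $E$ set $E^{<1>}=E$ and $E^{<k+1>}=E^{<k>}E$ for $k\ge1$ (the span of all products). $E$ is right nilpotent if $E^{<s>}=0$ for some $s\in\mathbb N$. *)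

theory Defs
  imports Complex_Main
begin

locale algebra_over = vector_space scale
  for scale :: "'k::field \<Rightarrow> 'a::ab_group_add \<Rightarrow> 'a" +
  fixes mult :: "'a \<Rightarrow> 'a \<Rightarrow> 'a"
  assumes linear_mult_left: "\<And>b. Vector_Spaces.linear scale scale (\<lambda>a. mult a b)"
    and linear_mult_right: "\<And>a. Vector_Spaces.linear scale scale (\<lambda>b. mult a b)"
begin

text \<open>The right powers are indexed from \<open>1\<close>; the value at \<open>0\<close> is a filler.\<close>

primrec right_power :: "nat \<Rightarrow> 'a set" where
  "right_power 0 = UNIV"
| "right_power (Suc k) =
    (if k = 0 then UNIV else span {mult a b | a b. a \<in> right_power k})"

definition right_nilpotent :: bool where
  "right_nilpotent \<longleftrightarrow> (\<exists>s\<ge>1. right_power s = {0})"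

end

text \<open>The dimension is \<open>CARD('n)\<close>.\<close>

locale based_algebra = algebra_over scale mult
  for scale :: "'k::field \<Rightarrow> 'a::ab_group_add \<Rightarrow> 'a" and mult +
  fixes e :: "'n::finite \<Rightarrow> 'a"
  assumes inj_basis: "inj e"
    and independent_basis: "independent (range e)"
    and span_basis: "span (range e) = UNIV"
begin

definition coord :: "'a \<Rightarrow> 'n \<Rightarrow> 'k" where
  "coord v i = representation (range e) v (e i)"

definition struct_const :: "'n \<Rightarrow> 'n \<Rightarrow> 'n \<Rightarrow> 'k" where
  "struct_const i j k = coord (mult (e i) (e j)) k"

definition approx_coeff :: "'a \<Rightarrow> 'n \<Rightarrow> 'n \<Rightarrow> 'k" where
  "approx_coeff x p k = (\<Sum>i\<in>UNIV. (struct_const p i k + struct_const i p k) * coord x i)"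

end

locale evolution_algebra = based_algebra scale mult e
  for scale :: "'k::field \<Rightarrow> 'a::ab_group_add \<Rightarrow> 'a" and mult
    and e :: "'n::finite \<Rightarrow> 'a" +
  assumes mult_distinct: "\<And>i j. i \<noteq> j \<Longrightarrow> mult (e i) (e j) = 0"

text \<open>
  The approximation at \<open>x\<close> is specified by its natural basis and multiplication
  table, so it is determined up to isomorphism only; its underlying vector space may
  be any space. The lemma \<open>ex_approximation\<close> below shows that it exists.
\<close>

definition (in based_algebra) is_approximation ::
  "'a \<Rightarrow> ('k \<Rightarrow> 'b::ab_group_add \<Rightarrow> 'b) \<Rightarrow> ('b \<Rightarrow> 'b \<Rightarrow> 'b) \<Rightarrow> ('n \<Rightarrow> 'b) \<Rightarrow> bool" where
  "is_approximation x scale' mult' e' \<longleftrightarrow>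
    evolution_algebra scale' mult' e' \<and>
    (\<forall>p. mult' (e' p) (e' p) = (\<Sum>k\<in>UNIV. scale' (approx_coeff x p k) (e' k)))"

lemma (in based_algebra) coord_basis: "coord (e i) j = (if i = j then 1 else 0)"
  using inj_basis
  by (auto simp: coord_def representation_basis[OF independent_basis] inj_eq)

lemma (in based_algebra) coord_add: "coord (u + v) i = coord u i + coord v i"
  using representation_add[OF independent_basis] span_basis by (simp add: coord_def)

lemma (in based_algebra) coord_scale: "coord (scale c v) i = c * coord v i"
  using representation_scale[OF independent_basis] span_basis by (simp add: coord_def)

lemma (in based_algebra) ex_approximation:
  "\<exists>mult'. is_approximation x scale mult' e"
proof -
  define m where "m u v = (\<Sum>p\<in>UNIV. \<Sum>k\<in>UNIV.
      scale (coord u p * coord v p * approx_coeff x p k) (e k))" for u v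
  have basis: "m (e i) (e j) =
      (if i = j then \<Sum>k\<in>UNIV. scale (approx_coeff x i k) (e k) else 0)" for i j
  proof -
    have "m (e i) (e j) = (\<Sum>p\<in>UNIV. if p = i then
        (if i = j then \<Sum>k\<in>UNIV. scale (approx_coeff x i k) (e k) else 0) else 0)"
      unfolding m_def by (intro sum.cong) (auto simp: coord_basis)
    then show ?thesis by simp
  qed
  have comm: "m u v = m v u" for u v
    by (simp add: m_def mult.commute)
  have add: "m (u + v) w = m u w + m v w" for u v w
    by (simp add: m_def coord_add distrib_right scale_left_distrib sum.distrib)
  have scl: "m (scale c u) w = scale c (m u w)" for c u w
    by (simp add: m_def coord_scale scale_sum_right mult.assoc)
  have lin: "Vector_Spaces.linear scale scale (\<lambda>u. m u v)" for v
    by unfold_locales (simp_all add: add scl)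
  have comm_eq: "(\<lambda>v. m u v) = (\<lambda>v. m v u)" for u
    by (rule ext) (rule comm)
  have "evolution_algebra scale m e"
  proof (intro evolution_algebra.intro based_algebra.intro algebra_over.intro
      algebra_over_axioms.intro based_algebra_axioms.intro evolution_algebra_axioms.intro)
    show "vector_space scale" by (rule vector_space_axioms)
    show "Vector_Spaces.linear scale scale (\<lambda>a. m a b)" for b by (rule lin)
    show "Vector_Spaces.linear scale scale (\<lambda>b. m a b)" for a
      unfolding comm_eq[of a] by (rule lin)
    show "inj e" by (rule inj_basis)
    show "independent (range e)" by (rule independent_basis)
    show "span (range e) = UNIV" by (rule span_basis)
    show "m (e i) (e j) = 0" if "i \<noteq> j" for i j
      using that by (simp add: basis)
  qed
  then show ?thesis
    unfolding is_approximation_def using basis by auto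
qed

end

theory Submission
  imports Defs
begin

text \<open>
  Draw an edge from \<open>p\<close> to \<open>q\<close> whenever \<open>e\<^sub>q\<close> occurs in \<open>e\<^sub>p e\<^sub>p\<close>. Multiplying an element
  of the \<open>k\<close>-th right power by \<open>e\<^sub>p\<close> extracts a multiple of \<open>e\<^sub>p e\<^sub>p\<close>, so the basis vectors
  occurring in \<open>E\<^bsup><k+1>\<^esup>\<close> are exactly the endpoints of walks of length \<open>k\<close>. Hence \<open>E\<close> is right
  nilpotent iff walk lengths are bounded. The approximation at \<open>x\<close> has coefficients
  \<open>2 x\<^sub>p a\<^sub>p\<^sub>k\<close>, so its graph is a subgraph of that of \<open>E\<close>.
\<close>

context algebra_over
begin

lemma mult_scale_left: "mult (scale c a) b = scale c (mult a b)"
  by (rule module_hom.scale[OF linear_mult_left[unfolded linear_iff_module_hom]])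

lemma mult_scale_right: "mult a (scale c b) = scale c (mult a b)"
  by (rule module_hom.scale[OF linear_mult_right[unfolded linear_iff_module_hom]])

lemma mult_sum_left: "mult (sum f I) b = (\<Sum>i\<in>I. mult (f i) b)"
  by (rule module_hom.sum[OF linear_mult_left[unfolded linear_iff_module_hom]])

lemma mult_sum_right: "mult a (sum f I) = (\<Sum>i\<in>I. mult a (f i))"
  by (rule module_hom.sum[OF linear_mult_right[unfolded linear_iff_module_hom]])

lemma zero_in_right_power: "0 \<in> right_power k"
  by (cases k) (auto simp: span_zero)

lemma mult_in_right_power:
  assumes "a \<in> right_power (Suc k)"
  shows "mult a b \<in> right_power (Suc (Suc k))"
  unfolding right_power.simps(2)[of "Suc k"] using assms
  by (auto intro: span_base simp del: right_power.simps)

end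

context based_algebra
begin

lemma coord_zero: "coord 0 i = 0"
  using coord_scale[of 0 0 i] by simp

lemma coord_sum: "coord (sum f I) i = (\<Sum>j\<in>I. coord (f j) i)"
  by (induction I rule: infinite_finite_induct) (simp_all add: coord_zero coord_add)

lemma sum_coord: "(\<Sum>i\<in>UNIV. scale (coord v i) (e i)) = v"
proof -
  have "(\<Sum>i\<in>UNIV. scale (coord v i) (e i)) =
      (\<Sum>b\<in>range e. scale (representation (range e) v b) b)"
    by (simp add: coord_def sum.reindex[OF inj_basis])
  also have "\<dots> = v"
    by (intro sum_representation_eq[OF independent_basis]) (auto simp: span_basis)
  finally show ?thesis .
qed

lemma coord_eq_0_imp_eq_0: "(\<And>i. coord v i = 0) \<Longrightarrow> v = 0"
  using sum_coord[of v] by simp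

definition edges :: "('n \<times> 'n) set" where
  "edges = {(p, q). struct_const p p q \<noteq> 0}"

end

context evolution_algebra
begin

text \<open>Bilinearity gives a double sum, which collapses to its diagonal because distinct natural
  basis vectors multiply to zero.\<close>

lemma coord_mult:
  "coord (mult v w) k = (\<Sum>i\<in>UNIV. coord v i * coord w i * struct_const i i k)"
proof -
  have "mult v w = mult (\<Sum>i\<in>UNIV. scale (coord v i) (e i)) (\<Sum>j\<in>UNIV. scale (coord w j) (e j))"
    by (simp add: sum_coord)
  also have "\<dots> = (\<Sum>i\<in>UNIV. \<Sum>j\<in>UNIV. scale (coord v i * coord w j) (mult (e i) (e j)))"
    unfolding mult_sum_left by (simp add: mult_sum_right mult_scale_left mult_scale_right
        scale_sum_right mult.commute)
  also have "\<dots> = (\<Sum>i\<in>UNIV. \<Sum>j\<in>UNIV.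
      if j = i then scale (coord v i * coord w i) (mult (e i) (e i)) else 0)"
    by (intro sum.cong) (auto simp: mult_distinct)
  also have "\<dots> = (\<Sum>i\<in>UNIV. scale (coord v i * coord w i) (mult (e i) (e i)))"
    by simp
  finally show ?thesis
    by (simp add: coord_sum coord_scale struct_const_def)
qed

lemma coord_mult_basis: "coord (mult v (e p)) k = coord v p * struct_const p p k"
proof -
  have "coord (mult v (e p)) k =
      (\<Sum>i\<in>UNIV. if i = p then coord v p * struct_const p p k else 0)"
    unfolding coord_mult by (intro sum.cong) (auto simp: coord_basis)
  then show ?thesis by simp
qed

text \<open>Right multiplication by \<open>e r\<close> isolates the \<open>r\<close>-coordinate, so
  a walk can be extended by one edge out of \<open>r\<close> without contributions of other vertices
  cancelling it.\<close>

lemma walk_end_occurs: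
  assumes "(p, q) \<in> edges ^^ k"
  shows "\<exists>v \<in> right_power (Suc k). coord v q \<noteq> 0"
  using assms
proof (induction k arbitrary: q)
  case 0
  \<comment> \<open>Walk length 0 pairs with power index 1, the whole algebra, so \<open>e q\<close>
    itself is a witness.\<close>
  show ?case by (intro bexI[of _ "e q"]) (auto simp: coord_basis)
next
  case (Suc k)
  then obtain r where r: "(p, r) \<in> edges ^^ k" "(r, q) \<in> edges" by auto
  then obtain v where v: "v \<in> right_power (Suc k)" "coord v r \<noteq> 0"
    using Suc.IH by blast
  have "coord (mult v (e r)) q \<noteq> 0"
    using v(2) r(2) by (simp add: coord_mult_basis edges_def)
  then show ?case using mult_in_right_power[OF v(1)] by blast
qed

text \<open>The vectors supported on endpoints of walks of a fixed length form a subspace, so only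
  the products spanning the right power need checking.\<close>

lemma occurring_is_walk_end:
  assumes "v \<in> right_power (Suc k)" "coord v q \<noteq> 0"
  shows "q \<in> Range (edges ^^ k)"
  using assms
proof (induction k arbitrary: v q)
  case 0
  show ?case by auto
next
  case (Suc k)
  let ?V = "{v. \<forall>q. coord v q \<noteq> 0 \<longrightarrow> q \<in> Range (edges ^^ Suc k)}"
  have "subspace ?V"
    by (rule subspaceI) (auto simp: coord_zero coord_add coord_scale, metis add_0)
  moreover have "mult a b \<in> ?V" if "a \<in> right_power (Suc k)" for a b
  proof clarify
    fix q assume "coord (mult a b) q \<noteq> 0"
    \<comment> \<open>A nonzero sum has a nonzero term; its index \<open>i\<close> is the last
      vertex before \<open>q\<close> on the walk.\<close>
    then obtain i where "coord a i * coord b i * struct_const i i q \<noteq> 0"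
      unfolding coord_mult by (meson sum.not_neutral_contains_not_neutral)
    then have "coord a i \<noteq> 0" "(i, q) \<in> edges" by (auto simp: edges_def)
    then show "q \<in> Range (edges ^^ Suc k)"
      using Suc.IH[OF that] by fastforce
  qed
  ultimately have "span {mult a b | a b. a \<in> right_power (Suc k)} \<subseteq> ?V"
    by (intro span_minimal) auto
  then show ?case using Suc.prems by auto
qed

lemma right_nilpotent_iff_walks_bounded: "right_nilpotent \<longleftrightarrow> (\<exists>k. edges ^^ k = {})"
proof
  assume right_nilpotent
  then obtain s where "s \<ge> 1" "right_power s = {0}"
    by (auto simp: right_nilpotent_def)
  \<comment> \<open>Since \<open>s \<ge> 1\<close>, the filler \<open>right_power 0\<close> is
    excluded and \<open>s\<close> has a predecessor, which is the walk length.\<close>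
  then obtain k where "right_power (Suc k) = {0}" by (cases s) auto
  then have "edges ^^ k = {}"
    using walk_end_occurs[of _ _ k] coord_zero by fastforce
  then show "\<exists>k. edges ^^ k = {}" ..
next
  assume "\<exists>k. edges ^^ k = {}"
  then obtain k where k: "edges ^^ k = {}" ..
  have "v = 0" if "v \<in> right_power (Suc k)" for v
    using occurring_is_walk_end[OF that] k by (intro coord_eq_0_imp_eq_0) auto
  then have "right_power (Suc k) = {0}"
    using zero_in_right_power by blast
  then show right_nilpotent
    unfolding right_nilpotent_def by (intro exI[of _ "Suc k"]) simp
qed

text \<open>Both structural constants vanish unless \<open>i = p\<close>, where they coincide; hence
  the factor 2.\<close>

lemma approx_coeff_eq: "approx_coeff x p k = 2 * struct_const p p k * coord x p"
proof -
  have "approx_coeff x p k =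
      (\<Sum>i\<in>UNIV. if i = p then 2 * struct_const p p k * coord x p else 0)"
    unfolding approx_coeff_def
    by (intro sum.cong) (auto simp: struct_const_def mult_distinct coord_zero)
  then show ?thesis by simp
qed

theorem right_nilpotent_approximation:
  fixes scale' :: "'k \<Rightarrow> 'b::ab_group_add \<Rightarrow> 'b"
  assumes nil: right_nilpotent and approx: "is_approximation x scale' mult' e'"
  shows "algebra_over.right_nilpotent scale' mult'"
proof -
  interpret A: evolution_algebra scale' mult' e'
    using approx by (simp add: is_approximation_def)
  have "A.struct_const p p q = approx_coeff x p q" for p q
  proof -
    have "A.struct_const p p q = (\<Sum>k\<in>UNIV. approx_coeff x p k * (if k = q then 1 else 0))"
      using approx unfolding A.struct_const_def
      by (simp add: is_approximation_def A.coord_sum A.coord_scale A.coord_basis)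
    then show ?thesis by (simp add: if_distrib cong: if_cong)
  qed
  \<comment> \<open>The two algebras may live on different spaces, but both graphs have the index
    type as vertex set. A nonzero \<open>approx_coeff x p q\<close> forces its factor
    \<open>struct_const p p q\<close> to be nonzero.\<close>
  then have sub: "A.edges \<subseteq> edges"
    by (auto simp: A.edges_def edges_def approx_coeff_eq)
  have "A.edges ^^ k \<subseteq> edges ^^ k" for k
    by (induction k) (use sub in \<open>auto intro: relcomp_mono\<close>)
  then show ?thesis
    using nil unfolding right_nilpotent_iff_walks_bounded A.right_nilpotent_iff_walks_bounded
    by blast
qed

end

theorem theorem2p9:
  "(\<forall>(scale :: real \<Rightarrow> 'a::ab_group_add \<Rightarrow> 'a) mult (e :: 'n::finite \<Rightarrow> 'a) x
      (scale' :: real \<Rightarrow> 'b::ab_group_add \<Rightarrow> 'b) mult' e'.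
      evolution_algebra scale mult e \<longrightarrow>
      algebra_over.right_nilpotent scale mult \<longrightarrow>
      based_algebra.is_approximation scale mult e x scale' mult' e' \<longrightarrow>
      algebra_over.right_nilpotent scale' mult') \<and>
   (\<forall>(scale :: complex \<Rightarrow> 'c::ab_group_add \<Rightarrow> 'c) mult (e :: 'm::finite \<Rightarrow> 'c) x
      (scale' :: complex \<Rightarrow> 'd::ab_group_add \<Rightarrow> 'd) mult' e'.
      evolution_algebra scale mult e \<longrightarrow>
      algebra_over.right_nilpotent scale mult \<longrightarrow>
      based_algebra.is_approximation scale mult e x scale' mult' e' \<longrightarrow>
      algebra_over.right_nilpotent scale' mult')"
  \<comment> \<open>The field is a type parameter of the rule, so the real and complex cases are two
    instances of it.\<close>
  by (intro conjI allI impI; rule evolution_algebra.right_nilpotent_approximation)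

end
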